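(* Consider the random (stopping) time $$\tau^{**}:=\inf\Big\{t\ge0:\int_0^t m(s)\,e^{3(\chi+k^2)s}\,ds\ge\frac{E^3(0)}{12\tilde\lambda}\Big\},$$ where $$m(s)=\min\Big\{e^{3k_{11}W(s)+3k_{12}B^H(s)},\ e^{(k_{11}+2k_{21})W(s)+(k_{12}+2k_{22})B^H(s)},\ e^{3k_{21}W(s)+3k_{22}B^H(s)},\ e^{(k_{21}+2k_{11})W(s)+(k_{22}+2k_{12})B^H(s)}\Big\},$$ $\tilde\lambda:=\min\{\lambda_{11}+\lambda_{22},\lambda_{12}+\lambda_{21}\}$, $k^2:=\min\{\frac{k_{11}^2}{2},\frac{k_{21}^2}{2}\}$ and $E(0):=\int_D[g_1(x)+g_2(x)]\psi(x)dx$. Then, on the event $\{\tau^{**}<\infty\}$, the solution $v=(v_1,v_2)^\top$ of the system (V) of the context, and thus the solution $z=(z_1,z_2)^\top$ of the system (Z) of the context, quenches in finite time $\tau_q$, where $\tau_q\le\tau^{**}$, $\mathbb P$-a.s.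
   Context: $D\subset\mathbb{R}^d$, $d\ge1$, is a bounded domain with smooth boundary $\partial D$ and outward unit normal $\nu$. The constants $\beta$, $\lambda_{i1},\lambda_{i2}$, $k_{i1},k_{i2}$ ($i=1,2$) are positive (no further relation between the $k_{ij}$ is assumed). On a filtered probability space $(\Omega,\mathcal F,(\mathcal F_t)_{t\ge0},\mathbb P)$, $W$ is a standard one-dimensional Brownian motion and $B^H$ is a one-dimensional fractional Brownian motion with Hurst index $H\in(1/2,1)$; $N_i(t):=k_{i1}W(t)+k_{i2}B^H(t)$. $g_i=1-f_i$ with $f_i\in C^2(D)$, $0\le f_i<1$, $f_i\not\equiv0$, so $0<g_i\le1$. Throughout $i=1,2$ and $j\in\{1,2\}\setminus\{i\}$. $(\chi,\psi)$ is the principal eigenpair of $-\Delta\psi=\chi\psi$ in $D$, $\frac{\partial\psi}{\partial\nu}+\beta\psi=0$ on $\partial D$, with $\chi>0$, $\psi>0$ and $\int_D\psi\,dx=1$. System (Z): $dz_i=[\Delta z_i-\lambda_{i1}z_i^{-2}-\lambda_{i2}z_j^{-2}]dt-z_i\,dN_i(t)$ for $t>0,\ x\in D$ (Itô integral for $W$, pathwise Young integral for $B^H$); $\frac{\partial z_i}{\partial\nu}+\beta z_i=0$ on $\partial D$, $t>0$; $z_i(0,x)=g_i(x)$, $x\in D$. System (V), obtained from (Z) by $v_i=e^{N_i(t)}z_i$: $\frac{\partial v_i}{\partial t}=(\Delta-\frac{k_{i1}^2}{2})v_i-\lambda_{i1}v_i^{-2}e^{3N_i(t)}-\lambda_{i2}v_j^{-2}e^{N_i(t)+2N_j(t)}$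 for $t>0,\ x\in D$; $\frac{\partial v_i}{\partial\nu}+\beta v_i=0$ on $\partial D$, $t>0$; $v_i(0,x)=g_i(x)$, $x\in D$. The solution $v$ is understood in the weak sense (equivalently mild): for every $\varphi_i\in C^2(D)$ with $\frac{\partial\varphi_i}{\partial\nu}+\beta\varphi_i=0$ on $\partial D$ and $t<\tau_q$, $\int_Dv_i(t)\varphi_i=\int_Dg_i\varphi_i+\int_0^t\int_Dv_i(s)(\Delta-\frac{k_{i1}^2}{2})\varphi_i\,ds-\lambda_{i1}\int_0^te^{3N_i(s)}\int_Dv_i^{-2}(s)\varphi_i\,ds-\lambda_{i2}\int_0^te^{N_i(s)+2N_j(s)}\int_Dv_j^{-2}(s)\varphi_i\,ds$. The quenching time $\tau_q$ (common to $v$ and $z$) is the stopping time such that $\lim_{t\to\tau_q}\min\{\min_{\bar D}|z_1(t,\cdot)|,\min_{\bar D}|z_2(t,\cdot)|\}=0$ a.s. on $\{\tau_q<\infty\}$; the solution is global if $\tau_q=\infty$. Infimum of the empty set is $+\infty$. *)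

theory Defs
  imports "HOL-Probability.Probability"
begin

section \<open>Domains with smooth boundary and the Robin Laplacian\<close>

definition partial_deriv :: "'a::euclidean_space \<Rightarrow> ('a \<Rightarrow> real) \<Rightarrow> 'a \<Rightarrow> real" where
  "partial_deriv b f = (\<lambda>x. frechet_derivative f (at x) b)"

definition grad :: "('a::euclidean_space \<Rightarrow> real) \<Rightarrow> 'a \<Rightarrow> 'a" where
  "grad f x = (\<Sum>b\<in>Basis. partial_deriv b f x *\<^sub>R b)"

definition laplacian :: "('a::euclidean_space \<Rightarrow> real) \<Rightarrow> 'a \<Rightarrow> real" where
  "laplacian f x = (\<Sum>b\<in>Basis. partial_deriv b (partial_deriv b f) x)"

text \<open>On an open set: all iterated partial derivatives exist and are (totally) differentiable.\<close>

definition smooth_fun_on :: "'a::euclidean_space set \<Rightarrow> ('a \<Rightarrow> real) \<Rightarrow> bool" where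
  "smooth_fun_on U f \<longleftrightarrow>
     (\<forall>bs. set bs \<subseteq> Basis \<longrightarrow> (\<forall>x\<in>U. foldr partial_deriv bs f differentiable (at x)))"

definition local_defining_fun ::
  "'a::euclidean_space set \<Rightarrow> 'a \<Rightarrow> 'a set \<Rightarrow> ('a \<Rightarrow> real) \<Rightarrow> bool" where
  "local_defining_fun D p U \<rho> \<longleftrightarrow>
     open U \<and> p \<in> U \<and> smooth_fun_on U \<rho> \<and> (\<forall>y\<in>U. grad \<rho> y \<noteq> 0) \<and>
     (\<forall>y\<in>U. (y \<in> D \<longleftrightarrow> \<rho> y < 0) \<and> (y \<in> frontier D \<longleftrightarrow> \<rho> y = 0))"

definition smooth_boundary :: "'a::euclidean_space set \<Rightarrow> bool" where
  "smooth_boundary D \<longleftrightarrow> (\<forall>p\<in>frontier D. \<exists>U \<rho>. local_defining_fun D p U \<rho>)"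

definition smooth_bounded_domain :: "'a::euclidean_space set \<Rightarrow> bool" where
  "smooth_bounded_domain D \<longleftrightarrow>
     open D \<and> connected D \<and> D \<noteq> {} \<and> bounded D \<and> smooth_boundary D"

definition outward_unit_normal ::
  "'a::euclidean_space set \<Rightarrow> ('a \<Rightarrow> 'a) \<Rightarrow> bool" where
  "outward_unit_normal D \<nu> \<longleftrightarrow>
     (\<forall>p\<in>frontier D. \<exists>U \<rho>. local_defining_fun D p U \<rho> \<and> \<nu> p = grad \<rho> p /\<^sub>R norm (grad \<rho> p))"

definition extends_cont :: "'a::euclidean_space set \<Rightarrow> ('a \<Rightarrow> real) \<Rightarrow> bool" where
  "extends_cont D f \<longleftrightarrow> (\<exists>h. continuous_on (closure D) h \<and> (\<forall>x\<in>D. h x = f x))"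

text \<open>Twice continuously differentiable up to the boundary; \<open>D\<close> is open.  The values of
  \<open>f\<close> on the boundary are not constrained here.\<close>

definition C2_upto_boundary :: "'a::euclidean_space set \<Rightarrow> ('a \<Rightarrow> real) \<Rightarrow> bool" where
  "C2_upto_boundary D f \<longleftrightarrow>
     (\<forall>x\<in>D. f differentiable (at x)) \<and>
     (\<forall>b\<in>Basis. \<forall>x\<in>D. partial_deriv b f differentiable (at x)) \<and>
     extends_cont D f \<and>
     (\<forall>b\<in>Basis. extends_cont D (partial_deriv b f)) \<and>
     (\<forall>b\<in>Basis. \<forall>c\<in>Basis. extends_cont D (partial_deriv c (partial_deriv b f)))"

text \<open>The normal derivative is the one-sided derivative taken from inside \<open>D\<close>:
  \<open>p + h *\<^sub>R \<nu> p\<close> lies in \<open>D\<close> for small \<open>h < 0\<close>.\<close>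

definition robin_bc ::
  "'a::euclidean_space set \<Rightarrow> ('a \<Rightarrow> 'a) \<Rightarrow> real \<Rightarrow> ('a \<Rightarrow> real) \<Rightarrow> bool" where
  "robin_bc D \<nu> \<beta> f \<longleftrightarrow>
     (\<forall>p\<in>frontier D. \<exists>q. ((\<lambda>h. f (p + h *\<^sub>R \<nu> p)) has_real_derivative q) (at_left 0) \<and>
        q + \<beta> * f p = 0)"

definition robin_test ::
  "'a::euclidean_space set \<Rightarrow> ('a \<Rightarrow> 'a) \<Rightarrow> real \<Rightarrow> ('a \<Rightarrow> real) \<Rightarrow> bool" where
  "robin_test D \<nu> \<beta> f \<longleftrightarrow>
     C2_upto_boundary D f \<and> continuous_on (closure D) f \<and> robin_bc D \<nu> \<beta> f"

definition robin_eigenpair ::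
  "'a::euclidean_space set \<Rightarrow> ('a \<Rightarrow> 'a) \<Rightarrow> real \<Rightarrow> real \<Rightarrow> ('a \<Rightarrow> real) \<Rightarrow> bool" where
  "robin_eigenpair D \<nu> \<beta> \<mu> f \<longleftrightarrow>
     robin_test D \<nu> \<beta> f \<and> (\<exists>x\<in>D. f x \<noteq> 0) \<and> (\<forall>x\<in>D. - laplacian f x = \<mu> * f x)"

definition principal_eigenpair ::
  "'a::euclidean_space set \<Rightarrow> ('a \<Rightarrow> 'a) \<Rightarrow> real \<Rightarrow> real \<Rightarrow> ('a \<Rightarrow> real) \<Rightarrow> bool" where
  "principal_eigenpair D \<nu> \<beta> chi \<psi> \<longleftrightarrow>
     robin_eigenpair D \<nu> \<beta> chi \<psi> \<and> (\<forall>\<mu> f. robin_eigenpair D \<nu> \<beta> \<mu> f \<longrightarrow> chi \<le> \<mu>) \<and>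
     chi > 0 \<and> (\<forall>x\<in>D. \<psi> x > 0) \<and> (LINT x:D|lborel. \<psi> x) = 1"


section \<open>Noise and stochastic integrals\<close>

text \<open>Processes are indexed by real time; only times \<open>t \<ge> 0\<close> matter.\<close>

definition filtered_prob_space :: "'w measure \<Rightarrow> (real \<Rightarrow> 'w measure) \<Rightarrow> bool" where
  "filtered_prob_space M F \<longleftrightarrow>
     prob_space M \<and> (\<forall>t\<ge>0. subalgebra M (F t)) \<and>
     (\<forall>s t. 0 \<le> s \<and> s \<le> t \<longrightarrow> sets (F s) \<subseteq> sets (F t))"

text \<open>The library's \<open>stopping_time\<close> takes values in the index type of the filtration, which
  would exclude the value \<open>\<infinity>\<close>.\<close>

definition ext_stopping_time :: "(real \<Rightarrow> 'w measure) \<Rightarrow> ('w \<Rightarrow> ereal) \<Rightarrow> bool" where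
  "ext_stopping_time F \<tau> \<longleftrightarrow>
     (\<forall>\<omega>. 0 \<le> \<tau> \<omega>) \<and> (\<forall>t\<ge>0. Measurable.pred (F t) (\<lambda>\<omega>. \<tau> \<omega> \<le> ereal t))"

definition brownian_motion ::
  "'w measure \<Rightarrow> (real \<Rightarrow> 'w measure) \<Rightarrow> (real \<Rightarrow> 'w \<Rightarrow> real) \<Rightarrow> bool" where
  "brownian_motion M F W \<longleftrightarrow>
     (\<forall>t\<ge>0. W t \<in> borel_measurable (F t)) \<and>
     (AE \<omega> in M. W 0 \<omega> = 0) \<and>
     (AE \<omega> in M. continuous_on {0..} (\<lambda>t. W t \<omega>)) \<and>
     (\<forall>s t. 0 \<le> s \<and> s < t \<longrightarrow>
        distributed M lborel (\<lambda>\<omega>. W t \<omega> - W s \<omega>) (normal_density 0 (sqrt (t - s))) \<and>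
        prob_space.indep_set M (sets (F s))
          {(\<lambda>\<omega>. W t \<omega> - W s \<omega>) -` A \<inter> space M | A. A \<in> sets borel})"

text \<open>Normal distribution, allowing variance zero.\<close>

definition gaussian_rv :: "'w measure \<Rightarrow> ('w \<Rightarrow> real) \<Rightarrow> bool" where
  "gaussian_rv M X \<longleftrightarrow> X \<in> borel_measurable M \<and>
     (\<exists>\<mu>. (AE \<omega> in M. X \<omega> = \<mu>) \<or> (\<exists>\<sigma>>0. distributed M lborel X (normal_density \<mu> \<sigma>)))"

definition gaussian_process :: "'w measure \<Rightarrow> (real \<Rightarrow> 'w \<Rightarrow> real) \<Rightarrow> bool" where
  "gaussian_process M X \<longleftrightarrow>
     (\<forall>T a. finite T \<and> T \<subseteq> {0..} \<longrightarrow> gaussian_rv M (\<lambda>\<omega>. \<Sum>t\<in>T. a t * X t \<omega>))"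

definition fractional_brownian_motion ::
  "'w measure \<Rightarrow> real \<Rightarrow> (real \<Rightarrow> 'w \<Rightarrow> real) \<Rightarrow> bool" where
  "fractional_brownian_motion M H B \<longleftrightarrow>
     gaussian_process M B \<and>
     (AE \<omega> in M. B 0 \<omega> = 0) \<and>
     (AE \<omega> in M. continuous_on {0..} (\<lambda>t. B t \<omega>)) \<and>
     (\<forall>t\<ge>0. (LINT \<omega>|M. B t \<omega>) = 0) \<and>
     (\<forall>s\<ge>0. \<forall>t\<ge>0. (LINT \<omega>|M. B s \<omega> * B t \<omega>) =
        (s powr (2 * H) + t powr (2 * H) - \<bar>t - s\<bar> powr (2 * H)) / 2)"

text \<open>A simple adapted integrand
  \<open>\<Sum>l<n. \<xi> l * indicator {p l<..p (Suc l)}\<close> and its integral over \<open>[0,t]\<close>.\<close>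

definition simple_adapted ::
  "'w measure \<Rightarrow> (real \<Rightarrow> 'w measure) \<Rightarrow> (nat \<Rightarrow> real) \<Rightarrow> (nat \<Rightarrow> 'w \<Rightarrow> real) \<Rightarrow> bool" where
  "simple_adapted M F p \<xi> \<longleftrightarrow>
     0 \<le> p 0 \<and> mono p \<and>
     (\<forall>l. \<xi> l \<in> borel_measurable (F (p l)) \<and> (\<exists>C. \<forall>\<omega>\<in>space M. \<bar>\<xi> l \<omega>\<bar> \<le> C))"

definition simple_val ::
  "(nat \<Rightarrow> real) \<Rightarrow> (nat \<Rightarrow> 'w \<Rightarrow> real) \<Rightarrow> nat \<Rightarrow> real \<Rightarrow> 'w \<Rightarrow> real" where
  "simple_val p \<xi> n s \<omega> = (\<Sum>l<n. \<xi> l \<omega> * indicator {p l<..p (Suc l)} s)"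

definition simple_ito ::
  "(real \<Rightarrow> 'w \<Rightarrow> real) \<Rightarrow> (nat \<Rightarrow> real) \<Rightarrow> (nat \<Rightarrow> 'w \<Rightarrow> real) \<Rightarrow> nat \<Rightarrow> real \<Rightarrow> 'w \<Rightarrow> real" where
  "simple_ito W p \<xi> n t \<omega> =
     (\<Sum>l<n. \<xi> l \<omega> * (W (min t (p (Suc l))) \<omega> - W (min t (p l)) \<omega>))"

text \<open>\<open>I t\<close> is the It\^o integral of \<open>X\<close> over \<open>[0,t]\<close> on the event \<open>t < \<tau>\<close>: simple adapted
  processes approximate \<open>X\<close> in \<open>L\<^sup>2(0,t)\<close> in probability on this event, and their integrals
  converge to \<open>I t\<close> in probability there.  The outer measure spares measurability conditions on
  \<open>X\<close> and \<open>I\<close> beyond time \<open>\<tau>\<close> (\<open>measure\<close> would be 0 on nonmeasurable sets).\<close>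

definition has_ito_integral ::
  "'w measure \<Rightarrow> (real \<Rightarrow> 'w measure) \<Rightarrow> (real \<Rightarrow> 'w \<Rightarrow> real) \<Rightarrow> ('w \<Rightarrow> ereal) \<Rightarrow>
   (real \<Rightarrow> 'w \<Rightarrow> real) \<Rightarrow> (real \<Rightarrow> 'w \<Rightarrow> real) \<Rightarrow> bool" where
  "has_ito_integral M F W \<tau> X I \<longleftrightarrow>
     (\<exists>p \<xi> n. (\<forall>m. simple_adapted M F (p m) (\<xi> m)) \<and>
       (\<forall>t\<ge>0. \<forall>\<epsilon>>0.
          (\<lambda>m. outer_measure_of M {\<omega>\<in>space M. ereal t < \<tau> \<omega> \<and>
             (\<integral>\<^sup>+s\<in>{0..t}. ennreal ((simple_val (p m) (\<xi> m) (n m) s \<omega> - X s \<omega>)\<^sup>2) \<partial>lborel)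
               > ennreal \<epsilon>}) \<longlonglongrightarrow> 0 \<and>
          (\<lambda>m. outer_measure_of M {\<omega>\<in>space M. ereal t < \<tau> \<omega> \<and>
             \<bar>simple_ito W (p m) (\<xi> m) (n m) t \<omega> - I t \<omega>\<bar> > \<epsilon>}) \<longlonglongrightarrow> 0))"

text \<open>Young integral \<open>\<integral>\<^sub>a\<^sup>b x dy\<close>: limit of tagged Riemann-Stieltjes sums as the mesh tends to 0.\<close>

definition has_young_integral ::
  "(real \<Rightarrow> real) \<Rightarrow> (real \<Rightarrow> real) \<Rightarrow> real \<Rightarrow> real \<Rightarrow> real \<Rightarrow> bool" where
  "has_young_integral x y a b J \<longleftrightarrow>
     (\<forall>\<epsilon>>0. \<exists>\<delta>>0. \<forall>(n::nat) p \<xi>.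
        p 0 = a \<and> p n = b \<and>
        (\<forall>l<n. p l \<le> \<xi> l \<and> \<xi> l \<le> p (Suc l) \<and> p (Suc l) - p l < \<delta>) \<longrightarrow>
        \<bar>(\<Sum>l<n. x (\<xi> l) * (y (p (Suc l)) - y (p l))) - J\<bar> < \<epsilon>)"


section \<open>The systems (Z) and (V)\<close>

text \<open>The components are indexed by \<open>i \<in> {1,2}\<close>, so the other index is \<open>3 - i\<close>.\<close>

definition noise ::
  "(nat \<Rightarrow> nat \<Rightarrow> real) \<Rightarrow> (real \<Rightarrow> 'w \<Rightarrow> real) \<Rightarrow> (real \<Rightarrow> 'w \<Rightarrow> real) \<Rightarrow> nat \<Rightarrow> real \<Rightarrow> 'w \<Rightarrow> real" where
  "noise k W B i t \<omega> = k i 1 * W t \<omega> + k i 2 * B t \<omega>"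

text \<open>Before time \<open>\<tau>\<close> the components are continuous on the closure of \<open>D\<close>, have the prescribed
  initial values, and do not vanish, so that the singular terms make sense.\<close>

definition regular_upto ::
  "'w measure \<Rightarrow> 'a::euclidean_space set \<Rightarrow> (nat \<Rightarrow> 'a \<Rightarrow> real) \<Rightarrow> ('w \<Rightarrow> ereal) \<Rightarrow>
   (nat \<Rightarrow> real \<Rightarrow> 'a \<Rightarrow> 'w \<Rightarrow> real) \<Rightarrow> bool" where
  "regular_upto M D g \<tau> u \<longleftrightarrow>
     (AE \<omega> in M. 0 < \<tau> \<omega> \<and>
        (\<forall>i\<in>{1,2}.
           continuous_on ({t. 0 \<le> t \<and> ereal t < \<tau> \<omega>} \<times> closure D) (\<lambda>(t, x). u i t x \<omega>) \<and>
           (\<forall>t x. 0 \<le> t \<and> ereal t < \<tau> \<omega> \<and> x \<in> closure D \<longrightarrow> u i t x \<omega> \<noteq> 0) \<and>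
           (\<forall>x\<in>D. u i 0 x \<omega> = g i x)))"

definition weak_solution_V ::
  "'w measure \<Rightarrow> 'a::euclidean_space set \<Rightarrow> ('a \<Rightarrow> 'a) \<Rightarrow> real \<Rightarrow>
   (nat \<Rightarrow> nat \<Rightarrow> real) \<Rightarrow> (nat \<Rightarrow> nat \<Rightarrow> real) \<Rightarrow> (real \<Rightarrow> 'w \<Rightarrow> real) \<Rightarrow> (real \<Rightarrow> 'w \<Rightarrow> real) \<Rightarrow>
   (nat \<Rightarrow> 'a \<Rightarrow> real) \<Rightarrow> ('w \<Rightarrow> ereal) \<Rightarrow> (nat \<Rightarrow> real \<Rightarrow> 'a \<Rightarrow> 'w \<Rightarrow> real) \<Rightarrow> bool" where
  "weak_solution_V M D \<nu> \<beta> lam k W B g \<tau> v \<longleftrightarrow>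
     regular_upto M D g \<tau> v \<and>
     (\<forall>i\<in>{1,2}. \<forall>\<phi>. robin_test D \<nu> \<beta> \<phi> \<longrightarrow>
        (AE \<omega> in M. \<forall>t. 0 \<le> t \<and> ereal t < \<tau> \<omega> \<longrightarrow>
           (LINT x:D|lborel. v i t x \<omega> * \<phi> x) =
             (LINT x:D|lborel. g i x * \<phi> x)
             + (LINT s:{0..t}|lborel. LINT x:D|lborel.
                  v i s x \<omega> * (laplacian \<phi> x - (k i 1)\<^sup>2 / 2 * \<phi> x))
             - lam i 1 * (LINT s:{0..t}|lborel. exp (3 * noise k W B i s \<omega>) *
                  (LINT x:D|lborel. v i s x \<omega> powi (-2) * \<phi> x))
             - lam i 2 * (LINT s:{0..t}|lborel.
                  exp (noise k W B i s \<omega> + 2 * noise k W B (3 - i) s \<omega>) *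
                  (LINT x:D|lborel. v (3 - i) s x \<omega> powi (-2) * \<phi> x))))"

text \<open>The It\^o-Young system, tested against \<open>\<phi>\<close>; \<open>dN\<^sub>i = k\<^sub>i\<^sub>1 dW + k\<^sub>i\<^sub>2 dB\<close>.\<close>

definition weak_solution_Z ::
  "'w measure \<Rightarrow> (real \<Rightarrow> 'w measure) \<Rightarrow> 'a::euclidean_space set \<Rightarrow> ('a \<Rightarrow> 'a) \<Rightarrow> real \<Rightarrow>
   (nat \<Rightarrow> nat \<Rightarrow> real) \<Rightarrow> (nat \<Rightarrow> nat \<Rightarrow> real) \<Rightarrow> (real \<Rightarrow> 'w \<Rightarrow> real) \<Rightarrow> (real \<Rightarrow> 'w \<Rightarrow> real) \<Rightarrow>
   (nat \<Rightarrow> 'a \<Rightarrow> real) \<Rightarrow> ('w \<Rightarrow> ereal) \<Rightarrow> (nat \<Rightarrow> real \<Rightarrow> 'a \<Rightarrow> 'w \<Rightarrow> real) \<Rightarrow> bool" where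
  "weak_solution_Z M F D \<nu> \<beta> lam k W B g \<tau> z \<longleftrightarrow>
     regular_upto M D g \<tau> z \<and>
     (\<forall>i\<in>{1,2}. \<forall>\<phi>. robin_test D \<nu> \<beta> \<phi> \<longrightarrow>
        (\<exists>I. has_ito_integral M F W \<tau> (\<lambda>s \<omega>. LINT x:D|lborel. z i s x \<omega> * \<phi> x) I \<and>
        (AE \<omega> in M. \<forall>t. 0 \<le> t \<and> ereal t < \<tau> \<omega> \<longrightarrow>
           (\<exists>J. has_young_integral (\<lambda>s. LINT x:D|lborel. z i s x \<omega> * \<phi> x) (\<lambda>s. B s \<omega>) 0 t J \<and>
           (LINT x:D|lborel. z i t x \<omega> * \<phi> x) =
             (LINT x:D|lborel. g i x * \<phi> x)
             + (LINT s:{0..t}|lborel. LINT x:D|lborel. z i s x \<omega> * laplacian \<phi> x)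
             - lam i 1 * (LINT s:{0..t}|lborel.
                  LINT x:D|lborel. z i s x \<omega> powi (-2) * \<phi> x)
             - lam i 2 * (LINT s:{0..t}|lborel.
                  LINT x:D|lborel. z (3 - i) s x \<omega> powi (-2) * \<phi> x)
             - k i 1 * I t \<omega> - k i 2 * J))))"

definition min_abs ::
  "'a::euclidean_space set \<Rightarrow> (nat \<Rightarrow> real \<Rightarrow> 'a \<Rightarrow> 'w \<Rightarrow> real) \<Rightarrow> 'w \<Rightarrow> real \<Rightarrow> real" where
  "min_abs D u \<omega> t =
     min (INF x\<in>closure D. \<bar>u 1 t x \<omega>\<bar>) (INF x\<in>closure D. \<bar>u 2 t x \<omega>\<bar>)"

definition quenches_at ::
  "'a::euclidean_space set \<Rightarrow> (nat \<Rightarrow> real \<Rightarrow> 'a \<Rightarrow> 'w \<Rightarrow> real) \<Rightarrow> 'w \<Rightarrow> ereal \<Rightarrow> bool" where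
  "quenches_at D u \<omega> T \<longleftrightarrow>
     T < \<infinity> \<and> (min_abs D u \<omega> \<longlongrightarrow> 0) (at_left (real_of_ereal T))"

definition quenching_time ::
  "'w measure \<Rightarrow> (real \<Rightarrow> 'w measure) \<Rightarrow> 'a::euclidean_space set \<Rightarrow>
   (nat \<Rightarrow> real \<Rightarrow> 'a \<Rightarrow> 'w \<Rightarrow> real) \<Rightarrow> ('w \<Rightarrow> ereal) \<Rightarrow> bool" where
  "quenching_time M F D u \<tau> \<longleftrightarrow>
     ext_stopping_time F \<tau> \<and> (AE \<omega> in M. \<tau> \<omega> < \<infinity> \<longrightarrow> quenches_at D u \<omega> (\<tau> \<omega>))"


section \<open>The time \<open>\<tau>\<^sup>*\<^sup>*\<close>\<close>

definition m_proc ::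
  "(nat \<Rightarrow> nat \<Rightarrow> real) \<Rightarrow> (real \<Rightarrow> 'w \<Rightarrow> real) \<Rightarrow> (real \<Rightarrow> 'w \<Rightarrow> real) \<Rightarrow> real \<Rightarrow> 'w \<Rightarrow> real" where
  "m_proc k W B s \<omega> = Min
     {exp (3 * k 1 1 * W s \<omega> + 3 * k 1 2 * B s \<omega>),
      exp ((k 1 1 + 2 * k 2 1) * W s \<omega> + (k 1 2 + 2 * k 2 2) * B s \<omega>),
      exp (3 * k 2 1 * W s \<omega> + 3 * k 2 2 * B s \<omega>),
      exp ((k 2 1 + 2 * k 1 1) * W s \<omega> + (k 2 2 + 2 * k 1 2) * B s \<omega>)}"

definition lam_tilde :: "(nat \<Rightarrow> nat \<Rightarrow> real) \<Rightarrow> real" where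
  "lam_tilde lam = min (lam 1 1 + lam 2 2) (lam 1 2 + lam 2 1)"

definition k_sq :: "(nat \<Rightarrow> nat \<Rightarrow> real) \<Rightarrow> real" where
  "k_sq k = min ((k 1 1)\<^sup>2 / 2) ((k 2 1)\<^sup>2 / 2)"

definition E0 ::
  "'a::euclidean_space set \<Rightarrow> (nat \<Rightarrow> 'a \<Rightarrow> real) \<Rightarrow> ('a \<Rightarrow> real) \<Rightarrow> real" where
  "E0 D g \<psi> = (LINT x:D|lborel. (g 1 x + g 2 x) * \<psi> x)"

definition tau_upper ::
  "'a::euclidean_space set \<Rightarrow> (nat \<Rightarrow> nat \<Rightarrow> real) \<Rightarrow> (nat \<Rightarrow> nat \<Rightarrow> real) \<Rightarrow>
   (real \<Rightarrow> 'w \<Rightarrow> real) \<Rightarrow> (real \<Rightarrow> 'w \<Rightarrow> real) \<Rightarrow> (nat \<Rightarrow> 'a \<Rightarrow> real) \<Rightarrow> real \<Rightarrow> ('a \<Rightarrow> real) \<Rightarrow>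
   'w \<Rightarrow> ereal" where
  "tau_upper D lam k W B g chi \<psi> \<omega> =
     Inf (ereal ` {t. 0 \<le> t \<and>
       (LINT s:{0..t}|lborel. m_proc k W B s \<omega> * exp (3 * (chi + k_sq k) * s))
         \<ge> E0 D g \<psi> ^ 3 / (12 * lam_tilde lam)})"

end

theory Submission
  imports Defs
begin

text \<open>
  Nonvanishing and continuity on the connected closure of \<open>D\<close> keep \<open>v\<^sub>i\<close> positive before
  \<open>\<tau>\<^sub>q\<close>.  Testing the weak equations with \<open>\<psi>\<close> gives an ordinary differential equation for
  \<open>E\<^sub>i = \<integral> v\<^sub>i \<psi>\<close>, and convexity of \<open>u \<mapsto> u\<^bsup>-2\<^esup>\<close> turns it into
  \<open>E' \<le> - (\<chi> + k\<^sup>2) E - 8 \<lambda> m E\<^bsup>-2\<^esup>\<close> for \<open>E = E\<^sub>1 + E\<^sub>2\<close>.  Hence \<open>(e\<^bsup>3(\<chi>+k\<^sup>2)t\<^esup> E\<^sup>3)' \<le> - 24 \<lambda> m e\<^bsup>3(\<chi>+k\<^sup>2)t\<^esup>\<close>,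
  and since \<open>E\<close> stays positive up to \<open>\<tau>\<^sub>q\<close>, the integral defining \<open>\<tau>\<^sup>*\<^sup>*\<close> is below
  \<open>E(0)\<^sup>3 / (24 \<lambda>)\<close> at every time before \<open>\<tau>\<^sub>q\<close>; the bound with 12 follows with room to spare.
  For \<open>z\<close>, the factors \<open>e\<^bsup>-N\<^sub>i\<^esup>\<close> are bounded on bounded time intervals.
\<close>

section \<open>Integrals over the bounded domain and over time intervals\<close>

lemma set_integrable_continuous_closure:
  fixes h :: "'a::euclidean_space \<Rightarrow> real"
  assumes "bounded D" and "D \<in> sets borel" and "continuous_on (closure D) h"
  shows "set_integrable lborel D h"
proof -
  have "set_integrable lborel (closure D) h"
    unfolding set_integrable_def
    using assms by (intro borel_integrable_compact) auto
  then show ?thesis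
    by (rule set_integrable_subset) (use assms closure_subset in auto)
qed

text \<open>Uniform continuity on the compact product makes nearby sections uniformly close on
  \<open>D\<close>, and \<open>D\<close> has finite measure. This yields continuity in time of the
  spatial averages of v and of its inverse square.\<close>

lemma continuous_on_LINT_param:
  fixes F :: "'b::metric_space \<Rightarrow> 'a::euclidean_space \<Rightarrow> real"
  assumes D: "bounded D" "D \<in> sets borel" and "compact S"
    and F: "continuous_on (S \<times> closure D) (\<lambda>(s, x). F s x)"
  shows "continuous_on S (\<lambda>s. LINT x:D|lborel. F s x)"
  unfolding continuous_on_iff
proof (intro ballI allI impI)
  fix s and e :: real
  assume s: "s \<in> S" and "e > 0"
  have sect: "continuous_on (closure D) (F r)" if "r \<in> S" for r
  proof -
    have "continuous_on (closure D) ((\<lambda>(s, x). F s x) \<circ> (\<lambda>x. (r, x)))"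
      by (intro continuous_on_compose continuous_intros continuous_on_subset[OF F])
         (use that in auto)
    then show ?thesis by (simp add: o_def)
  qed
  note int = set_integrable_continuous_closure[OF D sect]
  \<comment> \<open>Adding 1 covers a null \<open>D\<close> and makes
    \<open>e' * measure lborel D\<close> strictly smaller than \<open>e\<close>.\<close>
  define e' where "e' = e / (measure lborel D + 1)"
  have "measure lborel D + 1 > 0"
    by (simp add: add_nonneg_pos)
  then have e': "e' > 0" "e' * measure lborel D < e"
    using \<open>e > 0\<close> by (auto simp: e'_def field_simps)
  have "uniformly_continuous_on (S \<times> closure D) (\<lambda>(s, x). F s x)"
    using F \<open>compact S\<close> D by (intro compact_uniformly_continuous compact_Times) auto
  then obtain d where "d > 0" and d: "\<And>p q. p \<in> S \<times> closure D \<Longrightarrow> q \<in> S \<times> closure D \<Longrightarrow>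
      dist q p < d \<Longrightarrow> dist (case q of (s, x) \<Rightarrow> F s x) (case p of (s, x) \<Rightarrow> F s x) < e'"
    using e'(1) unfolding uniformly_continuous_on_def by metis
  have "dist (LINT x:D|lborel. F r x) (LINT x:D|lborel. F s x) < e"
    if r: "r \<in> S" "dist r s < d" for r
  proof -
    have close: "\<bar>F r x - F s x\<bar> \<le> e'" if "x \<in> D" for x
    proof -
      have "x \<in> closure D" using that closure_subset by auto
      then show ?thesis
        using d[of "(s, x)" "(r, x)"] r s by (auto simp: dist_Pair_Pair dist_real_def)
    qed
    have fin: "emeasure lborel D < \<infinity>"
      using emeasure_bounded_finite[OF D(1)] by simp
    have diff: "set_integrable lborel D (\<lambda>x. F r x - F s x)"
      using int[OF r(1)] int[OF s] by (rule set_integral_diff)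
    have "dist (LINT x:D|lborel. F r x) (LINT x:D|lborel. F s x)
        = \<bar>LINT x:D|lborel. F r x - F s x\<bar>"
      using int[OF r(1)] int[OF s] by (simp add: set_integral_diff dist_real_def)
    also have "\<dots> \<le> (LINT x:D|lborel. \<bar>F r x - F s x\<bar>)"
      using set_integral_norm_bound[OF diff] by simp
    also have "\<dots> \<le> (LINT x:D|lborel. e')"
      by (intro set_integral_mono set_integrable_abs diff close)
         (use fin D in \<open>auto simp: set_integrable_def\<close>)
    also have "\<dots> = e' * measure lborel D"
      using fin D by (simp add: set_lebesgue_integral_def measure_def)
    finally show ?thesis using e' by simp
  qed
  then show "\<exists>d>0. \<forall>r\<in>S. dist r s < d \<longrightarrow>
      dist (LINT x:D|lborel. F r x) (LINT x:D|lborel. F s x) < e"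
    using \<open>d > 0\<close> by blast
qed

text \<open>The fundamental theorem of calculus, carried over from the gauge integral, with which
  the Lebesgue integral agrees for continuous integrands. Differentiating within
  \<open>{0..T}\<close> includes the endpoints.\<close>

lemma LINT_has_real_derivative:
  fixes h :: "real \<Rightarrow> real"
  assumes h: "continuous_on {0..T} h" and t: "t \<in> {0..T}"
  shows "((\<lambda>t. LINT s:{0..t}|lborel. h s) has_real_derivative h t) (at t within {0..T})"
proof -
  have eq: "(LINT s:{0..r}|lborel. h s) = integral {0..r} h" if "r \<in> {0..T}" for r
    using that by (intro set_borel_integral_eq_integral borel_integrable_atLeastAtMost'
        continuous_on_subset[OF h]) auto
  show ?thesis
    by (rule has_field_derivative_transform_within[OF integral_has_real_derivative[OF h t]
          zero_less_one t]) (simp add: eq)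
qed

section \<open>Positivity and convexity of the inverse square\<close>

text \<open>The intermediate value theorem. Applied on the space-time cylinder, it carries the sign
  of the initial datum to all times before quenching and to the boundary.\<close>

lemma nonvanishing_pos:
  fixes u :: "'a::topological_space \<Rightarrow> real"
  assumes "connected S" and "continuous_on S u" and nz: "\<And>x. x \<in> S \<Longrightarrow> u x \<noteq> 0"
    and "a \<in> S" and "u a > 0" and "x \<in> S"
  shows "u x > 0"
proof (rule ccontr)
  assume "\<not> u x > 0"
  moreover have "connected (u ` S)"
    using assms by (intro connected_continuous_image)
  ultimately have "0 \<in> u ` S"
    using \<open>a \<in> S\<close> \<open>x \<in> S\<close> \<open>u a > 0\<close> unfolding connected_iff_interval
    by (meson imageI less_imp_le not_less)
  then show False using nz by auto
qed

text \<open>The convex function \<open>u powi (-2)\<close> lies above its tangent at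
  \<open>a\<close>, which is a^-2 - 2 a^-3 (u - a).\<close>

lemma inverse_square_tangent:
  fixes a u :: real
  assumes "a > 0" and "u > 0"
  shows "3 / a^2 - 2 * u / a^3 \<le> u powi (-2)"
proof -
  \<comment> \<open>After multiplication by a^3 u^2 the gap between the two sides is a^3 - 3 a u^2 +
    2 u^3, which has this factorization.\<close>
  have "0 \<le> (a - u)^2 * (a + 2 * u)"
    using assms by simp
  then have "3 * a * u^2 - 2 * u^3 \<le> a^3"
    by (simp add: power2_eq_square power3_eq_cube algebra_simps)
  then show ?thesis
    using assms by (simp add: power_int_minus field_simps power2_eq_square power3_eq_cube)
qed

text \<open>The tangent inequality integrated against the probability density \<open>w\<close>.
  Taking \<open>a\<close> equal to the mean of \<open>u\<close> would give Jensen's inequality;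
  \<open>a\<close> stays free so that two functions with different means can share one tangent
  point.\<close>

lemma weighted_inverse_square_tangent:
  fixes u w :: "'a::euclidean_space \<Rightarrow> real"
  assumes D: "bounded D" "D \<in> sets borel"
    and u: "continuous_on (closure D) u" "\<And>x. x \<in> closure D \<Longrightarrow> u x > 0"
    and w: "continuous_on (closure D) w" "\<And>x. x \<in> D \<Longrightarrow> w x \<ge> 0" "(LINT x:D|lborel. w x) = 1"
    and "a > 0"
  shows "3 / a^2 - 2 / a^3 * (LINT x:D|lborel. u x * w x) \<le> (LINT x:D|lborel. u x powi (-2) * w x)"
proof -
  have i: "set_integrable lborel D w" "set_integrable lborel D (\<lambda>x. u x * w x)"
    "set_integrable lborel D (\<lambda>x. u x powi (-2) * w x)"
    using u(2) by (intro set_integrable_continuous_closure D continuous_intros u w; force)+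
  have "3 / a^2 - 2 / a^3 * (LINT x:D|lborel. u x * w x)
      = (LINT x:D|lborel. 3 / a^2 * w x - 2 / a^3 * (u x * w x))"
    using i w(3) by simp
  also have "\<dots> \<le> (LINT x:D|lborel. u x powi (-2) * w x)"
  proof (rule set_integral_mono)
    fix x assume x: "x \<in> D"
    then have "u x > 0" using u(2) closure_subset by auto
    from mult_right_mono[OF inverse_square_tangent[OF \<open>a > 0\<close> this] w(2)[OF x]]
    show "3 / a^2 * w x - 2 / a^3 * (u x * w x) \<le> u x powi (-2) * w x"
      by (simp add: algebra_simps)
  qed (use i in auto)
  finally show ?thesis .
qed

text \<open>The minimum of \<open>u\<close> on the compact closure is positive, and it bounds the
  average from below because \<open>w\<close> has mass 1.\<close>

lemma weighted_integral_pos: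
  fixes u w :: "'a::euclidean_space \<Rightarrow> real"
  assumes D: "bounded D" "D \<in> sets borel" "D \<noteq> {}"
    and u: "continuous_on (closure D) u" "\<And>x. x \<in> closure D \<Longrightarrow> u x > 0"
    and w: "continuous_on (closure D) w" "\<And>x. x \<in> D \<Longrightarrow> w x \<ge> 0" "(LINT x:D|lborel. w x) = 1"
  shows "(LINT x:D|lborel. u x * w x) > 0"
proof -
  obtain p where p: "p \<in> closure D" "\<And>x. x \<in> closure D \<Longrightarrow> u p \<le> u x"
    using continuous_attains_inf[OF _ _ u(1)] D by auto
  have i: "set_integrable lborel D w" "set_integrable lborel D (\<lambda>x. u x * w x)"
    by (intro set_integrable_continuous_closure D continuous_intros u w)+
  have "0 < u p" using u p by auto
  also have "u p = (LINT x:D|lborel. u p * w x)"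
    using w by simp
  also have "\<dots> \<le> (LINT x:D|lborel. u x * w x)"
  proof (rule set_integral_mono)
    fix x assume "x \<in> D"
    then show "u p * w x \<le> u x * w x"
      using w(2) p(2) closure_subset by (intro mult_right_mono) auto
  qed (use i in auto)
  finally show ?thesis .
qed

section \<open>The differential inequality for the averaged system\<close>

text \<open>The inequality for \<open>h\<close> makes \<open>e\<^bsup>3ct\<^esup> y\<^sup>3 + 3b \<integral>\<^sub>0\<^sup>t q(s) e\<^bsup>3cs\<^esup> ds\<close> nonincreasing.\<close>

lemma cubic_comparison:
  fixes y h q :: "real \<Rightarrow> real"
  assumes "T \<ge> 0"
    and y: "\<And>t. t \<in> {0..T} \<Longrightarrow> (y has_real_derivative h t) (at t within {0..T})"
    and pos: "\<And>t. t \<in> {0..T} \<Longrightarrow> y t > 0"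
    and q: "continuous_on {0..T} q"
    and le: "\<And>t. t \<in> {0..T} \<Longrightarrow> h t \<le> - c * y t - b * q t / (y t)^2"
  shows "3 * b * (LINT s:{0..T}|lborel. q s * exp (3 * c * s)) < y 0 ^ 3"
proof -
  define G where "G t = exp (3 * c * t) * y t ^ 3
      + 3 * b * (LINT s:{0..t}|lborel. q s * exp (3 * c * s))" for t
  define G' where "G' t = exp (3 * c * t) * (3 * c * y t ^ 3 + 3 * (y t)^2 * h t + 3 * b * q t)" for t
  have "continuous_on {0..T} (\<lambda>s. q s * exp (3 * c * s))"
    by (intro continuous_intros q)
  note I = LINT_has_real_derivative[OF this]
  have G: "(G has_real_derivative G' t) (at t within {0..T})" if "t \<in> {0..T}" for t
    unfolding G_def G'_def
    by (rule derivative_eq_intros y I that refl | simp)+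
       (simp add: algebra_simps power2_eq_square power3_eq_cube)
  have G': "G' t \<le> 0" if t: "t \<in> {0..T}" for t
  proof -
    \<comment> \<open>The factor \<open>(y t)^2\<close>, which arises from differentiating the cube,
      cancels the singular denominator.\<close>
    have "(y t)^2 * h t \<le> (y t)^2 * (- c * y t - b * q t / (y t)^2)"
      using le[OF t] by (intro mult_left_mono) auto
    also have "\<dots> = - c * y t ^ 3 - b * q t"
      using pos[OF t] by (simp add: field_simps power2_eq_square power3_eq_cube)
    finally show ?thesis
      unfolding G'_def by (simp add: mult_le_0_iff)
  qed
  have "G T \<le> G 0"
  proof (cases "T = 0")
    case False
    show ?thesis
    proof (rule DERIV_nonpos_imp_decreasing_open[OF \<open>T \<ge> 0\<close>])
      fix t assume t: "0 < t" "t < T"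
      then have "(G has_real_derivative G' t) (at t within {0<..<T})"
        by (intro has_field_derivative_subset[OF G]) auto
      then have "(G has_real_derivative G' t) (at t)"
        using t by (subst (asm) at_within_open) auto
      then show "\<exists>d. (G has_real_derivative d) (at t) \<and> d \<le> 0"
        using G'[of t] t by auto
    qed (rule DERIV_continuous_on[OF G])
  qed simp
  moreover have "G 0 = y 0 ^ 3"
  proof -
    have "(LINT s:{0..0}|lborel. q s * exp (3 * c * s)) = 0"
      using set_borel_integral_eq_integral(2)[OF borel_integrable_atLeastAtMost',
          of 0 0 "\<lambda>s. q s * exp (3 * c * s)"] by simp
    then show ?thesis by (simp add: G_def)
  qed
  \<comment> \<open>Dropping this strictly positive part of \<open>G T\<close> makes the final
    inequality strict.\<close>
  moreover have "exp (3 * c * T) * y T ^ 3 > 0"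
    using pos[of T] \<open>T \<ge> 0\<close> by simp
  ultimately show ?thesis unfolding G_def by linarith
qed

text \<open>The tangent bound at \<open>a = (E 1 t + E 2 t) / 2\<close> gives \<open>P 1 t + P 2 t \<ge> 8 / (E 1 t + E 2 t)\<^sup>2\<close>.\<close>

lemma coupled_comparison:
  fixes E P N :: "nat \<Rightarrow> real \<Rightarrow> real" and lam :: "nat \<Rightarrow> nat \<Rightarrow> real" and \<kappa> :: "nat \<Rightarrow> real"
  defines "h \<equiv> \<lambda>i s. - \<kappa> i * E i s - lam i 1 * (exp (3 * N i s) * P i s)
      - lam i 2 * (exp (N i s + 2 * N (3 - i) s) * P (3 - i) s)"
  assumes "T \<ge> 0"
    and cont: "\<And>i. i \<in> {1, 2} \<Longrightarrow> continuous_on {0..T} (E i)"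
      "\<And>i. i \<in> {1, 2} \<Longrightarrow> continuous_on {0..T} (P i)"
      "\<And>i. i \<in> {1, 2} \<Longrightarrow> continuous_on {0..T} (N i)"
    and pos: "\<And>i t. i \<in> {1, 2} \<Longrightarrow> t \<in> {0..T} \<Longrightarrow> E i t > 0"
    and tangent: "\<And>i t a. i \<in> {1, 2} \<Longrightarrow> t \<in> {0..T} \<Longrightarrow> a > 0 \<Longrightarrow>
      3 / a^2 - 2 / a^3 * E i t \<le> P i t"
    and lam: "\<And>i j. i \<in> {1, 2} \<Longrightarrow> j \<in> {1, 2} \<Longrightarrow> lam i j > 0"
    and c: "\<And>i. i \<in> {1, 2} \<Longrightarrow> c \<le> \<kappa> i"
    and q: "continuous_on {0..T} q" "\<And>t. t \<in> {0..T} \<Longrightarrow> q t \<ge> 0"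
      "\<And>i t. i \<in> {1, 2} \<Longrightarrow> t \<in> {0..T} \<Longrightarrow> q t \<le> exp (3 * N i t)"
      "\<And>i t. i \<in> {1, 2} \<Longrightarrow> t \<in> {0..T} \<Longrightarrow> q t \<le> exp (N i t + 2 * N (3 - i) t)"
    and eq: "\<And>i t. i \<in> {1, 2} \<Longrightarrow> t \<in> {0..T} \<Longrightarrow>
      E i t = E i 0 + (LINT s:{0..t}|lborel. h i s)"
  shows "24 * lam_tilde lam * (LINT s:{0..T}|lborel. q s * exp (3 * c * s)) < (E 1 0 + E 2 0) ^ 3"
proof -
  \<comment> \<open>With \<open>h i\<close> continuous, the integral equation for \<open>E i\<close>
    can be differentiated at every time.\<close>
  have h: "continuous_on {0..T} (h i)" if "i \<in> {1, 2}" for i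
  proof -
    have "3 - i \<in> {1, 2}" using that by auto
    then show ?thesis
      unfolding h_def using that by (intro continuous_intros cont)
  qed
  have E: "(E i has_real_derivative h i t) (at t within {0..T})"
    if i: "i \<in> {1, 2}" and t: "t \<in> {0..T}" for i t
  proof -
    have "((\<lambda>t. E i 0 + (LINT s:{0..t}|lborel. h i s)) has_real_derivative h i t) (at t within {0..T})"
      using DERIV_add[OF DERIV_const LINT_has_real_derivative[OF h[OF i] t]] by simp
    then show ?thesis
      by (rule has_field_derivative_transform_within[OF _ zero_less_one t]) (metis eq[OF i])
  qed
  define L where "L = lam_tilde lam"
  \<comment> \<open>The 8 is the constant in the lower bound for \<open>P 1 t + P 2 t\<close>; the 3
    comes from differentiating a cube in \<open>cubic_comparison\<close>.\<close>
  have "3 * (8 * L) * (LINT s:{0..T}|lborel. q s * exp (3 * c * s)) < (E 1 0 + E 2 0) ^ 3"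
  proof (rule cubic_comparison[where y = "\<lambda>t. E 1 t + E 2 t" and h = "\<lambda>t. h 1 t + h 2 t"])
    show "((\<lambda>t. E 1 t + E 2 t) has_real_derivative h 1 t + h 2 t) (at t within {0..T})"
      if "t \<in> {0..T}" for t
      using that by (intro DERIV_add E) auto
    show "E 1 t + E 2 t > 0" if "t \<in> {0..T}" for t
      using that pos[of 1 t] pos[of 2 t] by simp
    show "h 1 t + h 2 t \<le> - c * (E 1 t + E 2 t) - 8 * L * q t / (E 1 t + E 2 t)^2"
      if t: "t \<in> {0..T}" for t
    proof -
      define a where "a = (E 1 t + E 2 t) / 2"
      have E_pos: "E 1 t > 0" "E 2 t > 0" and "a > 0"
        using pos[OF _ t, of 1] pos[OF _ t, of 2] by (auto simp: a_def)
      have P_ge: "P 1 t + P 2 t \<ge> 2 / a^2"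
      proof -
        have sum: "E 1 t + E 2 t = 2 * a" by (simp add: a_def)
        have "2 / a^2 = 6 / a^2 - 2 / a^3 * (E 1 t + E 2 t)"
          unfolding sum using \<open>a > 0\<close> by (simp add: field_simps power2_eq_square power3_eq_cube)
        also have "\<dots> = (3 / a^2 - 2 / a^3 * E 1 t) + (3 / a^2 - 2 / a^3 * E 2 t)"
          by (simp add: algebra_simps)
        also have "\<dots> \<le> P 1 t + P 2 t"
          using tangent[OF _ t \<open>a > 0\<close>] by (intro add_mono) auto
        finally show ?thesis .
      qed
      \<comment> \<open>Here the tangent point is \<open>E i t\<close> itself, which is Jensen's
        bound. The sign of each \<open>P i t\<close> matters because the coefficients of
        \<open>P 1 t\<close> and \<open>P 2 t\<close> are bounded separately below.\<close>
      have P_nonneg: "P i t \<ge> 0" if "i \<in> {1, 2}" for i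
      proof -
        note e = pos[OF that t]
        have "0 \<le> 1 / (E i t)^2" by simp
        also have "\<dots> = 3 / (E i t)^2 - 2 / (E i t)^3 * E i t"
          using e by (simp add: field_simps power2_eq_square power3_eq_cube)
        also have "\<dots> \<le> P i t" by (rule tangent[OF that t e])
        finally show ?thesis .
      qed
      have "L \<ge> 0" using lam[of 1 1] lam[of 1 2] lam[of 2 1] lam[of 2 2]
        by (simp add: L_def lam_tilde_def)
      \<comment> \<open>The sum of the two equations is regrouped by \<open>P\<close>:
        \<open>P 1 t\<close> occurs with \<open>lam 1 1\<close> in the first equation and with
        \<open>lam 2 2\<close> in the second. This explains the pairing of coefficients in
        \<open>lam_tilde\<close>; \<open>coeff2\<close> treats \<open>P 2 t\<close> in the same
        way.\<close>
      have coeff1: "L * q t \<le> lam 1 1 * exp (3 * N 1 t) + lam 2 2 * exp (N 2 t + 2 * N 1 t)"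
      proof -
        have "L * q t \<le> (lam 1 1 + lam 2 2) * q t"
          using q(2)[OF t] by (intro mult_right_mono) (auto simp: L_def lam_tilde_def)
        also have "\<dots> \<le> lam 1 1 * exp (3 * N 1 t) + lam 2 2 * exp (N 2 t + 2 * N 1 t)"
          using q(3)[OF _ t, of 1] q(4)[OF _ t, of 2] lam[of 1 1] lam[of 2 2]
          by (auto simp: distrib_right intro!: add_mono mult_left_mono)
        finally show ?thesis .
      qed
      have coeff2: "L * q t \<le> lam 2 1 * exp (3 * N 2 t) + lam 1 2 * exp (N 1 t + 2 * N 2 t)"
      proof -
        have "L * q t \<le> (lam 2 1 + lam 1 2) * q t"
          using q(2)[OF t] by (intro mult_right_mono) (auto simp: L_def lam_tilde_def)
        also have "\<dots> \<le> lam 2 1 * exp (3 * N 2 t) + lam 1 2 * exp (N 1 t + 2 * N 2 t)"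
          using q(3)[OF _ t, of 2] q(4)[OF _ t, of 1] lam[of 2 1] lam[of 1 2]
          by (auto simp: distrib_right intro!: add_mono mult_left_mono)
        finally show ?thesis .
      qed
      have "8 * L * q t / (E 1 t + E 2 t)^2 = L * q t * (2 / a^2)"
        by (simp add: a_def power_divide)
      also have "\<dots> \<le> L * q t * (P 1 t + P 2 t)"
        using P_ge \<open>L \<ge> 0\<close> q(2)[OF t] by (intro mult_left_mono) auto
      also have "\<dots> \<le> (lam 1 1 * exp (3 * N 1 t) + lam 2 2 * exp (N 2 t + 2 * N 1 t)) * P 1 t
          + (lam 2 1 * exp (3 * N 2 t) + lam 1 2 * exp (N 1 t + 2 * N 2 t)) * P 2 t"
        unfolding distrib_left
        using P_nonneg[of 1] P_nonneg[of 2]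
        by (intro add_mono mult_right_mono coeff1 coeff2) auto
      finally have sing: "8 * L * q t / (E 1 t + E 2 t)^2 \<le> \<dots>" .
      have lin: "c * E 1 t + c * E 2 t \<le> \<kappa> 1 * E 1 t + \<kappa> 2 * E 2 t"
        using c[of 1] c[of 2] E_pos by (intro add_mono mult_right_mono) auto
      show ?thesis
        using sing lin by (simp add: h_def algebra_simps)
    qed
  qed (use q \<open>T \<ge> 0\<close> in auto)
  then show ?thesis by (simp add: L_def)
qed

section \<open>From the weak formulation to a pathwise bound on the noise integral\<close>

text \<open>Pathwise, with \<omega> fixed: the \<psi>-averages of v and of its inverse square
  satisfy the hypotheses of \<open>coupled_comparison\<close> on any interval where v is continuous
  and nonvanishing.\<close>

lemma noise_integral_before_quenching:
  fixes D :: "'a::euclidean_space set" and v :: "nat \<Rightarrow> real \<Rightarrow> 'a \<Rightarrow> 'w \<Rightarrow> real"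
    and g :: "nat \<Rightarrow> 'a \<Rightarrow> real" and k lam :: "nat \<Rightarrow> nat \<Rightarrow> real"
  assumes D: "smooth_bounded_domain D"
    and lam: "\<forall>i\<in>{1,2}. \<forall>j\<in>{1,2}. lam i j > 0"
    and g: "\<And>i x. i \<in> {1,2} \<Longrightarrow> x \<in> D \<Longrightarrow> g i x > 0"
    and \<psi>: "principal_eigenpair D \<nu> \<beta> chi \<psi>"
    and "T \<ge> 0"
    and W: "continuous_on {0..T} (\<lambda>t. W t \<omega>)" and B: "continuous_on {0..T} (\<lambda>t. B t \<omega>)"
    and v: "\<And>i. i \<in> {1,2} \<Longrightarrow> continuous_on ({0..T} \<times> closure D) (\<lambda>(t, x). v i t x \<omega>)"
      "\<And>i t x. i \<in> {1,2} \<Longrightarrow> t \<in> {0..T} \<Longrightarrow> x \<in> closure D \<Longrightarrow> v i t x \<omega> \<noteq> 0"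
      "\<And>i x. i \<in> {1,2} \<Longrightarrow> x \<in> D \<Longrightarrow> v i 0 x \<omega> = g i x"
    and weak: "\<And>i t. i \<in> {1,2} \<Longrightarrow> t \<in> {0..T} \<Longrightarrow>
           (LINT x:D|lborel. v i t x \<omega> * \<psi> x) =
             (LINT x:D|lborel. g i x * \<psi> x)
             + (LINT s:{0..t}|lborel. LINT x:D|lborel.
                  v i s x \<omega> * (laplacian \<psi> x - (k i 1)\<^sup>2 / 2 * \<psi> x))
             - lam i 1 * (LINT s:{0..t}|lborel. exp (3 * noise k W B i s \<omega>) *
                  (LINT x:D|lborel. v i s x \<omega> powi (-2) * \<psi> x))
             - lam i 2 * (LINT s:{0..t}|lborel.
                  exp (noise k W B i s \<omega> + 2 * noise k W B (3 - i) s \<omega>) *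
                  (LINT x:D|lborel. v (3 - i) s x \<omega> powi (-2) * \<psi> x))"
  shows "24 * lam_tilde lam * (LINT s:{0..T}|lborel. m_proc k W B s \<omega> * exp (3 * (chi + k_sq k) * s))
           < E0 D g \<psi> ^ 3"
proof -
  have "open D" "connected D" "D \<noteq> {}" and bdd: "bounded D"
    using D by (auto simp: smooth_bounded_domain_def)
  then have meas: "D \<in> sets borel" by auto
  have \<psi>_cont: "continuous_on (closure D) \<psi>" and \<psi>_pos: "\<And>x. x \<in> D \<Longrightarrow> \<psi> x > 0"
    and \<psi>_int: "(LINT x:D|lborel. \<psi> x) = 1" and lap: "\<And>x. x \<in> D \<Longrightarrow> laplacian \<psi> x = - chi * \<psi> x"
    using \<psi> by (auto simp: principal_eigenpair_def robin_eigenpair_def robin_test_def minus_equation_iff)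
  have \<psi>_nonneg: "\<And>x. x \<in> D \<Longrightarrow> \<psi> x \<ge> 0" using \<psi>_pos less_imp_le by blast
  have v_pos: "v i t x \<omega> > 0" if i: "i \<in> {1,2}" and tx: "t \<in> {0..T}" "x \<in> closure D" for i t x
  proof -
    \<comment> \<open>A single point of \<open>D\<close> at time 0, where the datum is positive,
      fixes the sign on the whole connected cylinder.\<close>
    obtain x0 where x0: "x0 \<in> D" using \<open>D \<noteq> {}\<close> by auto
    have "(case (t, x) of (t, x) \<Rightarrow> v i t x \<omega>) > 0"
    proof (rule nonvanishing_pos[where u = "\<lambda>(t, x). v i t x \<omega>" and a = "(0, x0)"])
      show "connected ({0..T} \<times> closure D)"
        using \<open>connected D\<close> by (intro connected_Times connected_imp_connected_closure) auto
      show "(0, x0) \<in> {0..T} \<times> closure D"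
        using x0 \<open>T \<ge> 0\<close> closure_subset by auto
      show "(case p of (t, x) \<Rightarrow> v i t x \<omega>) \<noteq> 0" if "p \<in> {0..T} \<times> closure D" for p
        using that v(2)[OF i] by auto
      show "(case (0, x0) of (t, x) \<Rightarrow> v i t x \<omega>) > 0"
        using v(3)[OF i x0] g[OF i x0] by simp
    qed (use tx v(1)[OF i] in auto)
    then show ?thesis by simp
  qed
  have sect: "continuous_on (closure D) (\<lambda>x. v i t x \<omega>)" if "i \<in> {1,2}" "t \<in> {0..T}" for i t
  proof -
    have "continuous_on (closure D) ((\<lambda>(t, x). v i t x \<omega>) \<circ> (\<lambda>x. (t, x)))"
      using that by (intro continuous_on_compose continuous_intros continuous_on_subset[OF v(1)]) auto
    then show ?thesis by (simp add: o_def)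
  qed
  define E where "E i t = (LINT x:D|lborel. v i t x \<omega> * \<psi> x)" for i t
  define P where "P i t = (LINT x:D|lborel. v i t x \<omega> powi (-2) * \<psi> x)" for i t
  define N where "N i t = noise k W B i t \<omega>" for i t
  \<comment> \<open>By the eigenvalue equation, testing the operator \<Delta> - k^2/2 with \<psi>
    gives multiplication by \<open>- \<kappa> i\<close>.\<close>
  define \<kappa> where "\<kappa> i = chi + (k i 1)\<^sup>2 / 2" for i
  have \<psi>_snd: "continuous_on ({0..T} \<times> closure D) (\<lambda>p. \<psi> (snd p))"
    by (rule continuous_on_compose2[OF \<psi>_cont continuous_on_snd]) auto
  have E_cont: "continuous_on {0..T} (E i)" if i: "i \<in> {1,2}" for i
    unfolding E_def
    using continuous_on_mult[OF v(1)[OF i] \<psi>_snd]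
    by (intro continuous_on_LINT_param bdd meas) (auto simp: case_prod_beta)
  have P_cont: "continuous_on {0..T} (P i)" if i: "i \<in> {1,2}" for i
  proof -
    have "continuous_on ({0..T} \<times> closure D) (\<lambda>p. (case p of (t, x) \<Rightarrow> v i t x \<omega>) powi (-2) * \<psi> (snd p))"
      using v(2)[OF i] by (intro continuous_intros \<psi>_snd v(1)[OF i]) auto
    then show ?thesis
      unfolding P_def by (intro continuous_on_LINT_param bdd meas) (auto simp: case_prod_beta)
  qed
  have N_cont: "continuous_on {0..T} (N i)" for i
    unfolding N_def noise_def by (intro continuous_intros W B)
  define q where "q s = m_proc k W B s \<omega>" for s
  \<comment> \<open>The four exponents in \<open>m_proc\<close> are those of the four singular terms
    of the system, so \<open>q s\<close> is at most each of their noise factors.\<close>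
  have q_eq: "q s = min (exp (3 * N 1 s)) (min (exp (N 1 s + 2 * N 2 s))
      (min (exp (3 * N 2 s)) (exp (N 2 s + 2 * N 1 s))))" for s
    by (simp add: q_def m_proc_def N_def noise_def algebra_simps)
  have E_eq: "E i t = E i 0 + (LINT s:{0..t}|lborel. - \<kappa> i * E i s
      - lam i 1 * (exp (3 * N i s) * P i s) - lam i 2 * (exp (N i s + 2 * N (3 - i) s) * P (3 - i) s))"
    if i: "i \<in> {1,2}" and t: "t \<in> {0..T}" for i t
  proof -
    have j: "3 - i \<in> {1,2}" using i by auto
    have "E i 0 = (LINT x:D|lborel. g i x * \<psi> x)"
      unfolding E_def using meas v(3)[OF i] by (intro set_lebesgue_integral_cong) auto
    \<comment> \<open>This holds for every \<open>s\<close>, even outside \<open>{0..T}\<close>: the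
      integrands agree on \<open>D\<close>, and a scalar can be pulled out even where the integral
      takes its default value 0.\<close>
    moreover have "(LINT x:D|lborel. v i s x \<omega> * (laplacian \<psi> x - (k i 1)\<^sup>2 / 2 * \<psi> x)) = - \<kappa> i * E i s" for s
    proof -
      have "(LINT x:D|lborel. v i s x \<omega> * (laplacian \<psi> x - (k i 1)\<^sup>2 / 2 * \<psi> x))
          = (LINT x:D|lborel. - \<kappa> i * (v i s x \<omega> * \<psi> x))"
        using meas lap by (intro set_lebesgue_integral_cong) (auto simp: \<kappa>_def algebra_simps)
      also have "\<dots> = - \<kappa> i * E i s"
        unfolding E_def by (rule set_integral_mult_right)
      finally show ?thesis .
    qed
    \<comment> \<open>Merging the three time integrals of the weak equation into one requires each
      term to be integrable; continuity on the compact interval gives this.\<close>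
    moreover have "set_integrable lborel {0..t} (\<lambda>s. - \<kappa> i * E i s)"
      "set_integrable lborel {0..t} (\<lambda>s. lam i 1 * (exp (3 * N i s) * P i s))"
      "set_integrable lborel {0..t} (\<lambda>s. lam i 2 * (exp (N i s + 2 * N (3 - i) s) * P (3 - i) s))"
      using t by (intro borel_integrable_atLeastAtMost' continuous_intros
          continuous_on_subset[OF E_cont[OF i]] continuous_on_subset[OF P_cont[OF i]]
          continuous_on_subset[OF P_cont[OF j]] continuous_on_subset[OF N_cont]; force)+
    then have "(LINT s:{0..t}|lborel. - \<kappa> i * E i s
        - lam i 1 * (exp (3 * N i s) * P i s) - lam i 2 * (exp (N i s + 2 * N (3 - i) s) * P (3 - i) s))
      = (LINT s:{0..t}|lborel. - \<kappa> i * E i s)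
        - lam i 1 * (LINT s:{0..t}|lborel. exp (3 * N i s) * P i s)
        - lam i 2 * (LINT s:{0..t}|lborel. exp (N i s + 2 * N (3 - i) s) * P (3 - i) s)"
      by (simp only: set_integral_diff set_integral_mult_right)
    ultimately show ?thesis
      using weak[OF i t] unfolding E_def[symmetric] P_def[symmetric] N_def[symmetric]
      by simp
  qed
  have "24 * lam_tilde lam * (LINT s:{0..T}|lborel. q s * exp (3 * (chi + k_sq k) * s))
      < (E 1 0 + E 2 0) ^ 3"
  proof (rule coupled_comparison[where \<kappa> = \<kappa> and P = P and N = N, OF \<open>T \<ge> 0\<close>])
    show "continuous_on {0..T} q"
      unfolding q_eq by (intro continuous_intros N_cont)
    show "E i t > 0" if "i \<in> {1, 2}" "t \<in> {0..T}" for i t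
      unfolding E_def
      using that by (intro weighted_integral_pos bdd meas \<open>D \<noteq> {}\<close> sect \<psi>_cont \<psi>_nonneg \<psi>_int v_pos)
    show "3 / a^2 - 2 / a^3 * E i t \<le> P i t" if "i \<in> {1, 2}" "t \<in> {0..T}" "a > 0" for i t a
      unfolding E_def P_def
      using that by (intro weighted_inverse_square_tangent bdd meas sect \<psi>_cont \<psi>_nonneg \<psi>_int v_pos)
    show "lam i j > 0" if "i \<in> {1, 2}" "j \<in> {1, 2}" for i j
      using lam that by blast
    show "chi + k_sq k \<le> \<kappa> i" if "i \<in> {1, 2}" for i
      using that by (auto simp: \<kappa>_def k_sq_def)
    show "q t \<ge> 0" for t
      by (simp add: q_eq)
    show "q t \<le> exp (3 * N i t)" "q t \<le> exp (N i t + 2 * N (3 - i) t)" if "i \<in> {1, 2}" for i t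
      using that by (auto simp: q_eq)
  qed (rule E_eq E_cont P_cont N_cont; assumption)+
  also have "E 1 0 + E 2 0 = E0 D g \<psi>"
  proof -
    have int: "set_integrable lborel D (\<lambda>x. v i 0 x \<omega> * \<psi> x)" if "i \<in> {1,2}" for i
      using that \<open>T \<ge> 0\<close>
      by (intro set_integrable_continuous_closure bdd meas continuous_intros sect \<psi>_cont) auto
    have "E 1 0 + E 2 0 = (LINT x:D|lborel. v 1 0 x \<omega> * \<psi> x + v 2 0 x \<omega> * \<psi> x)"
      unfolding E_def using int[of 1] int[of 2] by simp
    also have "\<dots> = E0 D g \<psi>"
      unfolding E0_def using meas v(3) by (intro set_lebesgue_integral_cong) (auto simp: distrib_right)
    finally show ?thesis .
  qed
  finally show ?thesis by (simp add: q_def)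
qed

section \<open>Transfer of quenching between the two systems\<close>

lemma min_abs_scaled_le:
  fixes u w :: "nat \<Rightarrow> real \<Rightarrow> 'a::euclidean_space \<Rightarrow> 'w \<Rightarrow> real"
  assumes "D \<noteq> {}" and "C > 0"
    and le: "\<And>i x. i \<in> {1,2} \<Longrightarrow> x \<in> closure D \<Longrightarrow> \<bar>u i t x \<omega>\<bar> \<le> C * \<bar>w i t x \<omega>\<bar>"
  shows "min_abs D u \<omega> t \<le> C * min_abs D w \<omega> t"
proof -
  have inf_le: "(INF x\<in>closure D. \<bar>u i t x \<omega>\<bar>) \<le> C * (INF x\<in>closure D. \<bar>w i t x \<omega>\<bar>)"
    if i: "i \<in> {1,2}" for i
  proof -
    have "(INF x\<in>closure D. \<bar>u i t x \<omega>\<bar>) / C \<le> (INF x\<in>closure D. \<bar>w i t x \<omega>\<bar>)"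
    proof (rule cINF_greatest)
      fix x assume x: "x \<in> closure D"
      have "(INF x\<in>closure D. \<bar>u i t x \<omega>\<bar>) \<le> \<bar>u i t x \<omega>\<bar>"
        using x by (intro cINF_lower bdd_belowI2[where m = 0]) auto
      with le[OF i x] show "(INF x\<in>closure D. \<bar>u i t x \<omega>\<bar>) / C \<le> \<bar>w i t x \<omega>\<bar>"
        using \<open>C > 0\<close> by (simp add: field_simps)
    qed (use \<open>D \<noteq> {}\<close> in auto)
    then show ?thesis using \<open>C > 0\<close> by (simp add: field_simps)
  qed
  show ?thesis
    unfolding min_abs_def min_mult_distrib_left
    using \<open>C > 0\<close> inf_le[of 1] inf_le[of 2] by (auto simp: min_le_iff_disj)
qed

lemma min_abs_nonneg: "D \<noteq> {} \<Longrightarrow> min_abs D u \<omega> t \<ge> 0"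
  by (auto simp: min_abs_def intro!: cINF_greatest)

text \<open>A sandwich between 0 and \<open>C\<close> times the vanishing minimum for
  \<open>w\<close>. It is used with z as \<open>u\<close> and v as \<open>w\<close>.\<close>

lemma quenches_at_scaled:
  fixes u w :: "nat \<Rightarrow> real \<Rightarrow> 'a::euclidean_space \<Rightarrow> 'w \<Rightarrow> real"
  assumes D: "D \<noteq> {}" and "C > 0" and "T > 0"
    and le: "\<And>i t x. i \<in> {1,2} \<Longrightarrow> 0 \<le> t \<Longrightarrow> ereal t < T \<Longrightarrow> x \<in> closure D \<Longrightarrow>
      \<bar>u i t x \<omega>\<bar> \<le> C * \<bar>w i t x \<omega>\<bar>"
    and w: "quenches_at D w \<omega> T"
  shows "quenches_at D u \<omega> T"
proof -
  obtain r where r: "T = ereal r" "r > 0"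
    using w \<open>T > 0\<close> by (cases T) (auto simp: quenches_at_def)
  have lim: "(min_abs D w \<omega> \<longlongrightarrow> 0) (at_left r)"
    using w r by (simp add: quenches_at_def)
  have "(min_abs D u \<omega> \<longlongrightarrow> 0) (at_left r)"
  proof (rule tendsto_sandwich)
    show "\<forall>\<^sub>F t in at_left r. 0 \<le> min_abs D u \<omega> t"
      using D by (simp add: min_abs_nonneg)
    \<comment> \<open>Since \<open>r\<close> is positive, times close to \<open>r\<close> from the
      left are positive too, so the pointwise bound applies there.\<close>
    show "\<forall>\<^sub>F t in at_left r. min_abs D u \<omega> t \<le> C * min_abs D w \<omega> t"
      using eventually_at_left_real[OF \<open>r > 0\<close>]
    proof eventually_elim
      case (elim t)
      then show ?case
        using r by (intro min_abs_scaled_le D \<open>C > 0\<close> le) auto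
    qed
    show "((\<lambda>t. C * min_abs D w \<omega> t) \<longlongrightarrow> 0) (at_left r)"
      using tendsto_mult_right_zero[OF lim] .
  qed simp
  then show ?thesis using r by (simp add: quenches_at_def)
qed

text \<open>Continuous paths are bounded on compact intervals. The noise is continuous for all
  times, so the bound holds up to and including the quenching time, where v and z need no longer be
  controlled.\<close>

lemma noise_bounded:
  assumes "continuous_on {0..} (\<lambda>t. W t \<omega>)" and "continuous_on {0..} (\<lambda>t. B t \<omega>)"
  obtains C where "C > 0" and "\<And>i t. i \<in> {1,2} \<Longrightarrow> 0 \<le> t \<Longrightarrow> t \<le> r \<Longrightarrow> exp (- noise k W B i t \<omega>) \<le> C"
proof -
  have "\<exists>c. \<forall>t\<in>{0..r}. exp (- noise k W B i t \<omega>) \<le> c" for i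
  proof -
    have "continuous_on {0..r} (\<lambda>t. exp (- noise k W B i t \<omega>))"
      unfolding noise_def
      by (intro continuous_intros continuous_on_subset[OF assms(1)] continuous_on_subset[OF assms(2)]) auto
    then have "bounded ((\<lambda>t. exp (- noise k W B i t \<omega>)) ` {0..r})"
      by (intro compact_imp_bounded compact_continuous_image) auto
    then show ?thesis
      unfolding bounded_iff by (auto simp: image_iff)
  qed
  then obtain c where "\<And>i t. t \<in> {0..r} \<Longrightarrow> exp (- noise k W B i t \<omega>) \<le> c i"
    by metis
  then show ?thesis
    \<comment> \<open>The entry 1 in the maximum guarantees a positive constant.\<close>
    by (intro that[of "max 1 (max (c 1) (c 2))"]) (force simp: le_max_iff_disj)+
qed

section \<open>Almost sure comparison of the two times, and quenching of v and z\<close>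

theorem corollary4p2:
  fixes M :: "'w measure" and F :: "real \<Rightarrow> 'w measure"
    and D :: "'a::euclidean_space set" and \<nu> :: "'a \<Rightarrow> 'a"
    and \<beta> H chi :: real and lam k :: "nat \<Rightarrow> nat \<Rightarrow> real"
    and W B :: "real \<Rightarrow> 'w \<Rightarrow> real"
    and f g :: "nat \<Rightarrow> 'a \<Rightarrow> real" and \<psi> :: "'a \<Rightarrow> real"
    and v :: "nat \<Rightarrow> real \<Rightarrow> 'a \<Rightarrow> 'w \<Rightarrow> real" and \<tau>\<^sub>q :: "'w \<Rightarrow> ereal"
  assumes "smooth_bounded_domain D" and "outward_unit_normal D \<nu>"
    and "\<beta> > 0"
    and "\<forall>i\<in>{1,2}. \<forall>j\<in>{1,2}. lam i j > 0"
    and "\<forall>i\<in>{1,2}. \<forall>j\<in>{1,2}. k i j > 0"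
    and "filtered_prob_space M F" and "brownian_motion M F W"
    and "1 / 2 < H" and "H < 1" and "fractional_brownian_motion M H B"
    and "\<forall>i\<in>{1,2}. C2_upto_boundary D (f i) \<and> (\<forall>x\<in>D. 0 \<le> f i x \<and> f i x < 1) \<and>
           (\<exists>x\<in>D. f i x \<noteq> 0)"
    and "\<forall>i\<in>{1,2}. \<forall>x\<in>D. g i x = 1 - f i x"
    and "principal_eigenpair D \<nu> \<beta> chi \<psi>"
    and "weak_solution_V M D \<nu> \<beta> lam k W B g \<tau>\<^sub>q v"
    and "quenching_time M F D v \<tau>\<^sub>q"
  shows "(AE \<omega> in M. tau_upper D lam k W B g chi \<psi> \<omega> < \<infinity> \<longrightarrow>
            quenches_at D v \<omega> (\<tau>\<^sub>q \<omega>) \<and> \<tau>\<^sub>q \<omega> \<le> tau_upper D lam k W B g chi \<psi> \<omega>) \<and>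
         (\<forall>z. weak_solution_Z M F D \<nu> \<beta> lam k W B g \<tau>\<^sub>q z \<and>
            (AE \<omega> in M. \<forall>i\<in>{1,2}. \<forall>t x. 0 \<le> t \<and> ereal t < \<tau>\<^sub>q \<omega> \<and> x \<in> closure D \<longrightarrow>
               v i t x \<omega> = exp (noise k W B i t \<omega>) * z i t x \<omega>) \<longrightarrow>
            (AE \<omega> in M. tau_upper D lam k W B g chi \<psi> \<omega> < \<infinity> \<longrightarrow>
               quenches_at D z \<omega> (\<tau>\<^sub>q \<omega>) \<and> \<tau>\<^sub>q \<omega> \<le> tau_upper D lam k W B g chi \<psi> \<omega>))"
proof -
  have W: "AE \<omega> in M. continuous_on {0..} (\<lambda>t. W t \<omega>)"
    using assms(7) by (simp add: brownian_motion_def)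
  have B: "AE \<omega> in M. continuous_on {0..} (\<lambda>t. B t \<omega>)"
    using assms(10) by (simp add: fractional_brownian_motion_def)
  have reg: "AE \<omega> in M. 0 < \<tau>\<^sub>q \<omega> \<and>
        (\<forall>i\<in>{1,2}.
           continuous_on ({t. 0 \<le> t \<and> ereal t < \<tau>\<^sub>q \<omega>} \<times> closure D) (\<lambda>(t, x). v i t x \<omega>) \<and>
           (\<forall>t x. 0 \<le> t \<and> ereal t < \<tau>\<^sub>q \<omega> \<and> x \<in> closure D \<longrightarrow> v i t x \<omega> \<noteq> 0) \<and>
           (\<forall>x\<in>D. v i 0 x \<omega> = g i x))"
    using assms(14) unfolding weak_solution_V_def regular_upto_def by blast
  \<comment> \<open>The exceptional null set of the weak formulation depends on the test function
    and on the index. Fixing \<psi> leaves two null sets, whose union is null.\<close>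
  have "robin_test D \<nu> \<beta> \<psi>"
    using assms(13) by (simp add: principal_eigenpair_def robin_eigenpair_def)
  then have weak: "AE \<omega> in M. \<forall>i\<in>{1,2}. \<forall>t. 0 \<le> t \<and> ereal t < \<tau>\<^sub>q \<omega> \<longrightarrow>
           (LINT x:D|lborel. v i t x \<omega> * \<psi> x) =
             (LINT x:D|lborel. g i x * \<psi> x)
             + (LINT s:{0..t}|lborel. LINT x:D|lborel.
                  v i s x \<omega> * (laplacian \<psi> x - (k i 1)\<^sup>2 / 2 * \<psi> x))
             - lam i 1 * (LINT s:{0..t}|lborel. exp (3 * noise k W B i s \<omega>) *
                  (LINT x:D|lborel. v i s x \<omega> powi (-2) * \<psi> x))
             - lam i 2 * (LINT s:{0..t}|lborel.
                  exp (noise k W B i s \<omega> + 2 * noise k W B (3 - i) s \<omega>) *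
                  (LINT x:D|lborel. v (3 - i) s x \<omega> powi (-2) * \<psi> x))"
    using assms(14) unfolding weak_solution_V_def by (intro AE_finite_allI) blast+
  have g: "g i x > 0" if "i \<in> {1,2}" "x \<in> D" for i x
    using assms(11,12) that by fastforce
  have lam_pos: "lam_tilde lam > 0"
  proof -
    have "lam 1 1 > 0" "lam 2 2 > 0" "lam 1 2 > 0" "lam 2 1 > 0"
      using assms(4) by blast+
    then show ?thesis by (simp add: lam_tilde_def)
  qed
  have D: "D \<noteq> {}" using assms(1) by (simp add: smooth_bounded_domain_def)
  have le: "AE \<omega> in M. \<tau>\<^sub>q \<omega> \<le> tau_upper D lam k W B g chi \<psi> \<omega>"
    using W B reg weak
  proof eventually_elim
    case (elim \<omega>)
    show ?case
      unfolding tau_upper_def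
    \<comment> \<open>Every time in the set defining \<open>tau_upper\<close> is shown to be at
      least \<open>\<tau>\<^sub>q \<omega>\<close>. This covers the empty set, whose infimum is
      \<infinity>. For contradiction, such a time \<open>t\<close> is taken strictly before
      quenching, so that v is regular on all of \<open>{0..t}\<close>.\<close>
    proof (rule Inf_greatest, clarify, rule ccontr)
      fix t
      assume t: "0 \<le> t" "\<not> \<tau>\<^sub>q \<omega> \<le> ereal t"
        and ge: "(LINT s:{0..t}|lborel. m_proc k W B s \<omega> * exp (3 * (chi + k_sq k) * s))
          \<ge> E0 D g \<psi> ^ 3 / (12 * lam_tilde lam)"
      have before: "r \<in> {r. 0 \<le> r \<and> ereal r < \<tau>\<^sub>q \<omega>}" if "r \<in> {0..t}" for r
        using that t by (auto simp: not_le intro: le_less_trans[of _ "ereal t"])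
      have "24 * lam_tilde lam * (LINT s:{0..t}|lborel. m_proc k W B s \<omega> * exp (3 * (chi + k_sq k) * s))
           < E0 D g \<psi> ^ 3"
      proof (rule noise_integral_before_quenching[OF assms(1,4) g assms(13) t(1)])
        show "continuous_on {0..t} (\<lambda>t. W t \<omega>)" "continuous_on {0..t} (\<lambda>t. B t \<omega>)"
          using elim(1,2) by (auto intro: continuous_on_subset)
        show "continuous_on ({0..t} \<times> closure D) (\<lambda>(t, x). v i t x \<omega>)" if "i \<in> {1,2}" for i
          using elim(3) that before by (blast intro: continuous_on_subset)
        show "v i r x \<omega> \<noteq> 0" if "i \<in> {1,2}" "r \<in> {0..t}" "x \<in> closure D" for i r x
          using elim(3) that before by blast
        show "v i 0 x \<omega> = g i x" if "i \<in> {1,2}" "x \<in> D" for i x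
          using elim(3) that by blast
      qed (assumption | rule elim(4)[rule_format] | use before in auto)+
      moreover have "E0 D g \<psi> ^ 3 \<le>
          12 * lam_tilde lam * (LINT s:{0..t}|lborel. m_proc k W B s \<omega> * exp (3 * (chi + k_sq k) * s))"
        using ge lam_pos by (simp add: field_simps)
      \<comment> \<open>Let X be this product. The two previous bounds give 24 X < 12 X, which is
        absurd only once X is known to be nonnegative.\<close>
      moreover have "lam_tilde lam * (LINT s:{0..t}|lborel. m_proc k W B s \<omega> * exp (3 * (chi + k_sq k) * s)) \<ge> 0"
        using lam_pos unfolding set_lebesgue_integral_def
        by (intro mult_nonneg_nonneg Bochner_Integration.integral_nonneg) (auto simp: m_proc_def)
      ultimately show False by linarith
    qed
  qed
  have quench: "AE \<omega> in M. \<tau>\<^sub>q \<omega> < \<infinity> \<longrightarrow> quenches_at D v \<omega> (\<tau>\<^sub>q \<omega>)"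
    using assms(15) by (simp add: quenching_time_def)
  have quench_z: "AE \<omega> in M. \<tau>\<^sub>q \<omega> < \<infinity> \<longrightarrow> quenches_at D z \<omega> (\<tau>\<^sub>q \<omega>)"
    if "AE \<omega> in M. \<forall>i\<in>{1,2}. \<forall>t x. 0 \<le> t \<and> ereal t < \<tau>\<^sub>q \<omega> \<and> x \<in> closure D \<longrightarrow>
      v i t x \<omega> = exp (noise k W B i t \<omega>) * z i t x \<omega>" for z
    using that W B reg quench
  proof eventually_elim
    case (elim \<omega>)
    show ?case
    proof
      assume fin: "\<tau>\<^sub>q \<omega> < \<infinity>"
      obtain r where r: "\<tau>\<^sub>q \<omega> = ereal r"
        using fin elim(4) by (cases "\<tau>\<^sub>q \<omega>") auto
      obtain C where C: "C > 0"
        "\<And>i t. i \<in> {1,2} \<Longrightarrow> 0 \<le> t \<Longrightarrow> t \<le> r \<Longrightarrow> exp (- noise k W B i t \<omega>) \<le> C"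
        using noise_bounded[where W = W and B = B and \<omega> = \<omega>, OF elim(2,3)] by blast
      show "quenches_at D z \<omega> (\<tau>\<^sub>q \<omega>)"
      \<comment> \<open>Inverting the transformation gives z = e^(-N) v, and \<open>C\<close> bounds
        the factor e^(-N) up to the quenching time.\<close>
      proof (rule quenches_at_scaled[OF D C(1)])
        fix i :: nat and t x
        assume i: "i \<in> {1,2}" and t: "0 \<le> t" "ereal t < \<tau>\<^sub>q \<omega>" and x: "x \<in> closure D"
        have "v i t x \<omega> = exp (noise k W B i t \<omega>) * z i t x \<omega>"
          using elim(1) i t x by blast
        then have "\<bar>z i t x \<omega>\<bar> = exp (- noise k W B i t \<omega>) * \<bar>v i t x \<omega>\<bar>"
          by (simp add: abs_mult exp_minus)
        also have "\<dots> \<le> C * \<bar>v i t x \<omega>\<bar>"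
          using C(2)[OF i t(1)] t(2) r by (intro mult_right_mono) auto
        finally show "\<bar>z i t x \<omega>\<bar> \<le> C * \<bar>v i t x \<omega>\<bar>" .
      qed (use elim fin in auto)
    qed
  qed
  show ?thesis
  proof (intro conjI allI impI)
    show "AE \<omega> in M. tau_upper D lam k W B g chi \<psi> \<omega> < \<infinity> \<longrightarrow>
        quenches_at D v \<omega> (\<tau>\<^sub>q \<omega>) \<and> \<tau>\<^sub>q \<omega> \<le> tau_upper D lam k W B g chi \<psi> \<omega>"
      \<comment> \<open>On the event that \<open>tau_upper\<close> is finite, \<open>le\<close>
        makes \<open>\<tau>\<^sub>q \<omega>\<close> finite, and then \<open>quench\<close>
        applies.\<close>
      using le quench by eventually_elim auto
    show "AE \<omega> in M. tau_upper D lam k W B g chi \<psi> \<omega> < \<infinity> \<longrightarrow>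
        quenches_at D z \<omega> (\<tau>\<^sub>q \<omega>) \<and> \<tau>\<^sub>q \<omega> \<le> tau_upper D lam k W B g chi \<psi> \<omega>"
      if "weak_solution_Z M F D \<nu> \<beta> lam k W B g \<tau>\<^sub>q z \<and>
            (AE \<omega> in M. \<forall>i\<in>{1,2}. \<forall>t x. 0 \<le> t \<and> ereal t < \<tau>\<^sub>q \<omega> \<and> x \<in> closure D \<longrightarrow>
               v i t x \<omega> = exp (noise k W B i t \<omega>) * z i t x \<omega>)" for z
      using le quench_z[OF conjunct2[OF that]] by eventually_elim auto
  qed
qed

end
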